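(* Consider the system, observer and estimation error dynamics described in the context. Let $0<\lambda<1$ be given, and suppose there exist constants $a>0$, $b>0$, $\gamma>0$, $\mu_w>0$, $\mu_v>0$, a symmetric positive definite matrix $P\in\mathbb{R}^{n_x\times n_x}$, and matrices $W\in\mathbb{R}^{n_x\times n_y}$, $U\in\mathbb{R}^{n_x\times n_x}$ such that, with $\mu=\mu_w+\mu_v$, for all $J\in[\underline{J},\overline{J}]$ the following matrix inequalities hold: $$\begin{bmatrix} \Phi_{11} & * & * & * & * & *\\ -aI_{n_x} & -bI_{n_x} & * & * & * & *\\ 0 & 0 & -\gamma I_{n_w} & * & * & *\\ 0 & 0 & 0 & -\gamma I_{n_v} & * & *\\ \Phi_{51} & P & PD_1 & -WD_2 & -P & *\\ UJ & 0 & 0 & 0 & 0 & \Phi_{66} \end{bmatrix}\prec 0,\qquad \begin{bmatrix} \lambda P & * & * & *\\ 0 & (\mu_w-\gamma)I_{n_w} & * & *\\ 0 & 0 & (\mu_v-\gamma)I_{n_v} & *\\ I_{n_x} & 0 & 0 & \mu I_{n_x} \end{bmatrix}\succ 0,$$ where $\Phi_{11}=\lambda P-P+a(J+J^{\mathrm T})$, $\Phi_{51}=PA-WC$, $\Phi_{66}=bI_{n_x}-U-U^{\mathrm T}$. Then, with the observer gain $L=P^{-1}W$, the estimation error dynamics $$e_{k+1}=(A-LC)e_k+\Delta f_k+D_1w_k-LD_2v_k$$ is input-to-state stable with respect to the inputs $(w_k,v_k)$, and its solution satisfies, for all $k\ge 0$, the peak-to-peak performance bound $$\|e_k\|_2\le\sqrt{\mu\left(\lambda(1-\lambda)^kV_0+\mu_w\,\overline{w}^{\mathrm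 T}\overline{w}+\mu_v\,\overline{v}^{\mathrm T}\overline{v}\right)},\qquad V_0=e_0^{\mathrm T}Pe_0.$$ In particular, this applies with $L=P^{-1}W$ to any solution of the problem of minimizing $\mu$ over $a,b,\gamma,\mu_w,\mu_v,P,W,U$ subject to the two matrix inequalities above (for all $J\in[\underline{J},\overline{J}]$).
   Context: Notation: inequalities and absolute values of vectors and matrices are elementwise; $\succ 0$ ($\prec 0$) means symmetric positive (negative) definite; $*$ in a symmetric matrix denotes the block determined by symmetry; $I_n$ is the $n\times n$ identity. For matrices $\underline{J}\le\overline{J}$, $[\underline{J},\overline{J}]$ is the set of matrices $J$ with $\underline{J}\le J\le\overline{J}$ elementwise. System: for $k\ge0$, $$x_{k+1}=Ax_k+Bu_k+f(x_k)+D_1w_k,\qquad y_k=Cx_k+D_2v_k,$$ with state $x_k\in\mathbb{R}^{n_x}$, output $y_k\in\mathbb{R}^{n_y}$, input $u_k\in\mathbb{R}^{n_u}$, process disturbance $w_k\in\mathbb{R}^{n_w}$, measurement noise $v_k\in\mathbb{R}^{n_v}$; $A,B,C,D_1,D_2$ are known real matrices of suitable sizes and $f:\mathbb{R}^{n_x}\to\mathbb{R}^{n_x}$ is differentiable. Standing assumption on $f$: $\mathcal{X}\subseteq\mathbb{R}^{n_x}$ is the feasible domain of the state, in which $x_k$ and $\hat{x}_k$ lie for all $k$; known matrices $\underline{J},\overline{J}\in\mathbb{R}^{n_x\times n_x}$ satisfy $\underline{J}\le\frac{\partial f}{\partial x}(x)\le\overline{J}$ for all $x\in\mathcal{X}$;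 and, as a consequence, for any $p,q\in\mathcal{X}$ there is a matrix $J\in[\underline{J},\overline{J}]$ such that, with $\Delta f=f(p)-f(q)$, $$\Delta f^{\mathrm T}(p-q)\le(p-q)^{\mathrm T}J(p-q),\qquad \Delta f^{\mathrm T}\Delta f\le(p-q)^{\mathrm T}J^{\mathrm T}J(p-q).$$ (This property is part of the setting and may be used.) Standing assumption on uncertainties: $|w_k|\le\overline{w}$, $|v_k|\le\overline{v}$ for all $k\ge0$, and $|x_0-p_0|\le\overline{x}_0$, where $\overline{w}\in\mathbb{R}^{n_w}$, $\overline{v}\in\mathbb{R}^{n_v}$, $\overline{x}_0,p_0\in\mathbb{R}^{n_x}$ are known. Observer: $\hat{x}_{k+1}=A\hat{x}_k+Bu_k+f(\hat{x}_k)+L(y_k-C\hat{x}_k)$ with gain $L\in\mathbb{R}^{n_x\times n_y}$. Estimation error: $e_k=x_k-\hat{x}_k$; $\Delta f_k=f(x_k)-f(\hat{x}_k)$. Input-to-state stability means: there exist a class-$\mathcal{KL}$ function $\beta$ and a class-$\mathcal{K}$ function $\sigma$ such that along every trajectory (with $x_k,\hat{x}_k\in\mathcal{X}$) $\|e_k\|_2\le\beta(\|e_0\|_2,k)+\sigma\left(\sup_{0\le i<k}\|(w_i,v_i)\|_2\right)$ for all $k\ge0$. *)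

theory Defs
  imports "HOL-Analysis.Analysis"
begin

definition pos_def :: "real^'n^'n \<Rightarrow> bool" where
  "pos_def M \<longleftrightarrow> transpose M = M \<and> (\<forall>z. z \<noteq> 0 \<longrightarrow> z \<bullet> (M *v z) > 0)"

definition neg_def :: "real^'n^'n \<Rightarrow> bool" where
  "neg_def M \<longleftrightarrow> transpose M = M \<and> (\<forall>z. z \<noteq> 0 \<longrightarrow> z \<bullet> (M *v z) < 0)"

text \<open>Block matrices are indexed by sum types. A symmetric block matrix is entered by its
  block columns on and below the diagonal, so \<open>sym_block M11 M21 M22\<close> is
  \<open>[M11, *; M21, M22]\<close>, and \<open>X \<Zsemi> Y\<close> places \<open>X\<close> above \<open>Y\<close>. More than two
  blocks are obtained by nesting in the last argument.\<close>

definition vstack :: "real^'k^'m \<Rightarrow> real^'k^'n \<Rightarrow> real^'k^('m + 'n)" (infixr "\<Zsemi>" 60) where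
  "X \<Zsemi> Y = (\<chi> i j. case i of Inl r \<Rightarrow> X $ r $ j | Inr r \<Rightarrow> Y $ r $ j)"

definition sym_block ::
    "real^'m^'m \<Rightarrow> real^'m^'n \<Rightarrow> real^'n^'n \<Rightarrow> real^('m + 'n)^('m + 'n)" where
  "sym_block M11 M21 M22 = (\<chi> i j.
     case i of
       Inl r \<Rightarrow> (case j of Inl c \<Rightarrow> M11 $ r $ c | Inr c \<Rightarrow> M21 $ c $ r)
     | Inr r \<Rightarrow> (case j of Inl c \<Rightarrow> M21 $ r $ c | Inr c \<Rightarrow> M22 $ r $ c))"

definition class_K :: "(real \<Rightarrow> real) \<Rightarrow> bool" where
  "class_K \<sigma> \<longleftrightarrow> continuous_on {0..} \<sigma> \<and> strict_mono_on {0..} \<sigma> \<and> \<sigma> 0 = 0"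

definition class_KL :: "(real \<Rightarrow> real \<Rightarrow> real) \<Rightarrow> bool" where
  "class_KL \<beta> \<longleftrightarrow>
     continuous_on ({0..} \<times> {0..}) (\<lambda>(r, t). \<beta> r t) \<and>
     (\<forall>t\<ge>0. class_K (\<lambda>r. \<beta> r t)) \<and>
     (\<forall>r\<ge>0. antimono_on {0..} (\<beta> r) \<and> (\<beta> r \<longlongrightarrow> 0) at_top)"

text \<open>The predicate \<open>T e w v\<close> says that \<open>e\<close> is a trajectory for the inputs \<open>w\<close> and \<open>v\<close>.
  The norm on pairs is the Euclidean norm of the stacked vector. Inserting \<open>0\<close> only matters for
  \<open>k = 0\<close>, where the supremum of the empty family of norms is to be \<open>0\<close>.\<close>

definition input_to_state_stable ::
    "((nat \<Rightarrow> real^'n) \<Rightarrow> (nat \<Rightarrow> real^'w) \<Rightarrow> (nat \<Rightarrow> real^'v) \<Rightarrow> bool) \<Rightarrow> bool" where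
  "input_to_state_stable T \<longleftrightarrow>
     (\<exists>\<beta> \<sigma>. class_KL \<beta> \<and> class_K \<sigma> \<and>
       (\<forall>e w v. T e w v \<longrightarrow>
         (\<forall>k. norm (e k) \<le> \<beta> (norm (e 0)) (real k)
                + \<sigma> (Sup (insert 0 ((\<lambda>i. norm (w i, v i)) ` {..<k}))))))"

definition plant_dynamics ::
    "real^'nx^'nx \<Rightarrow> real^'nu^'nx \<Rightarrow> real^'nx^'ny \<Rightarrow> real^'nw^'nx \<Rightarrow> real^'nv^'ny \<Rightarrow>
     (real^'nx \<Rightarrow> real^'nx) \<Rightarrow>
     (nat \<Rightarrow> real^'nu) \<Rightarrow> (nat \<Rightarrow> real^'nw) \<Rightarrow> (nat \<Rightarrow> real^'nv) \<Rightarrow>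
     (nat \<Rightarrow> real^'nx) \<Rightarrow> (nat \<Rightarrow> real^'ny) \<Rightarrow> bool" where
  "plant_dynamics A B C D1 D2 f u w v x y \<longleftrightarrow>
     (\<forall>k. x (Suc k) = A *v x k + B *v u k + f (x k) + D1 *v w k \<and>
          y k = C *v x k + D2 *v v k)"

definition observer_dynamics ::
    "real^'nx^'nx \<Rightarrow> real^'nu^'nx \<Rightarrow> real^'nx^'ny \<Rightarrow> (real^'nx \<Rightarrow> real^'nx) \<Rightarrow> real^'ny^'nx \<Rightarrow>
     (nat \<Rightarrow> real^'nu) \<Rightarrow> (nat \<Rightarrow> real^'ny) \<Rightarrow> (nat \<Rightarrow> real^'nx) \<Rightarrow> bool" where
  "observer_dynamics A B C f L u y xh \<longleftrightarrow>
     (\<forall>k. xh (Suc k) = A *v xh k + B *v u k + f (xh k) + L *v (y k - C *v xh k))"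

definition trajectory ::
    "real^'nx^'nx \<Rightarrow> real^'nu^'nx \<Rightarrow> real^'nx^'ny \<Rightarrow> real^'nw^'nx \<Rightarrow> real^'nv^'ny \<Rightarrow>
     (real^'nx \<Rightarrow> real^'nx) \<Rightarrow> (real^'nx) set \<Rightarrow> real^'ny^'nx \<Rightarrow>
     (nat \<Rightarrow> real^'nw) \<Rightarrow> (nat \<Rightarrow> real^'nv) \<Rightarrow>
     (nat \<Rightarrow> real^'nx) \<Rightarrow> (nat \<Rightarrow> real^'nx) \<Rightarrow> bool" where
  "trajectory A B C D1 D2 f X L w v x xh \<longleftrightarrow>
     (\<forall>k. x k \<in> X \<and> xh k \<in> X) \<and>
     (\<exists>u y. plant_dynamics A B C D1 D2 f u w v x y \<and> observer_dynamics A B C f L u y xh)"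

definition error_trajectory ::
    "real^'nx^'nx \<Rightarrow> real^'nu^'nx \<Rightarrow> real^'nx^'ny \<Rightarrow> real^'nw^'nx \<Rightarrow> real^'nv^'ny \<Rightarrow>
     (real^'nx \<Rightarrow> real^'nx) \<Rightarrow> (real^'nx) set \<Rightarrow> real^'ny^'nx \<Rightarrow>
     (nat \<Rightarrow> real^'nx) \<Rightarrow> (nat \<Rightarrow> real^'nw) \<Rightarrow> (nat \<Rightarrow> real^'nv) \<Rightarrow> bool" where
  "error_trajectory A B C D1 D2 f X L e w v \<longleftrightarrow>
     (\<exists>x xh. trajectory A B C D1 D2 f X L w v x xh \<and> e = (\<lambda>k. x k - xh k))"

definition stability_lmi ::
    "real^'nx^'nx \<Rightarrow> real^'nx^'ny \<Rightarrow> real^'nw^'nx \<Rightarrow> real^'nv^'ny \<Rightarrow> real \<Rightarrow>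
     real \<Rightarrow> real \<Rightarrow> real \<Rightarrow> real^'nx^'nx \<Rightarrow> real^'ny^'nx \<Rightarrow> real^'nx^'nx \<Rightarrow> real^'nx^'nx \<Rightarrow>
     real^('nx + 'nx + 'nw + 'nv + 'nx + 'nx)^('nx + 'nx + 'nw + 'nv + 'nx + 'nx)" where
  "stability_lmi A C D1 D2 lam a b \<gamma> P W U J =
     sym_block (lam *\<^sub>R P - P + a *\<^sub>R (J + transpose J))
               (mat (- a) \<Zsemi> 0 \<Zsemi> 0 \<Zsemi> P ** A - W ** C \<Zsemi> U ** J)
    (sym_block (mat (- b)) (0 \<Zsemi> 0 \<Zsemi> P \<Zsemi> 0)
    (sym_block (mat (- \<gamma>)) (0 \<Zsemi> P ** D1 \<Zsemi> 0)
    (sym_block (mat (- \<gamma>)) (- (W ** D2) \<Zsemi> 0)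
    (sym_block (- P) 0
               (mat b - U - transpose U)))))"

definition performance_lmi ::
    "real \<Rightarrow> real \<Rightarrow> real \<Rightarrow> real \<Rightarrow> real^'nx^'nx \<Rightarrow>
     real^('nx + 'nw::finite + 'nv::finite + 'nx)^('nx + 'nw + 'nv + 'nx)" where
  "performance_lmi lam \<gamma> \<mu>w \<mu>v P =
     sym_block (lam *\<^sub>R P) (0 \<Zsemi> 0 \<Zsemi> mat 1)
    (sym_block (mat (\<mu>w - \<gamma>)) (0 \<Zsemi> 0)
    (sym_block (mat (\<mu>v - \<gamma>)) 0
               (mat (\<mu>w + \<mu>v))))"

definition lmi_feasible ::
    "real^'nx^'nx \<Rightarrow> real^'nx^'ny \<Rightarrow> real^'nw^'nx \<Rightarrow> real^'nv^'ny \<Rightarrow>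
     real^'nx^'nx \<Rightarrow> real^'nx^'nx \<Rightarrow> real \<Rightarrow>
     real \<Rightarrow> real \<Rightarrow> real \<Rightarrow> real \<Rightarrow> real \<Rightarrow>
     real^'nx^'nx \<Rightarrow> real^'ny^'nx \<Rightarrow> real^'nx^'nx \<Rightarrow> bool" where
  "lmi_feasible A C (D1 :: real^'nw^'nx) (D2 :: real^'nv^'ny) Jl Ju lam a b \<gamma> \<mu>w \<mu>v P W U \<longleftrightarrow>
     a > 0 \<and> b > 0 \<and> \<gamma> > 0 \<and> \<mu>w > 0 \<and> \<mu>v > 0 \<and> pos_def P \<and>
     (\<forall>J\<in>{Jl..Ju}.
        neg_def (stability_lmi A C D1 D2 lam a b \<gamma> P W U J) \<and>
        pos_def (performance_lmi lam \<gamma> \<mu>w \<mu>v P ::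
          real^('nx + 'nw + 'nv + 'nx)^('nx + 'nw + 'nv + 'nx)))"

definition lmi_optimal ::
    "real^'nx^'nx \<Rightarrow> real^'nx^'ny \<Rightarrow> real^'nw^'nx \<Rightarrow> real^'nv^'ny \<Rightarrow>
     real^'nx^'nx \<Rightarrow> real^'nx^'nx \<Rightarrow> real \<Rightarrow>
     real \<Rightarrow> real \<Rightarrow> real \<Rightarrow> real \<Rightarrow> real \<Rightarrow>
     real^'nx^'nx \<Rightarrow> real^'ny^'nx \<Rightarrow> real^'nx^'nx \<Rightarrow> bool" where
  "lmi_optimal A C D1 D2 Jl Ju lam a b \<gamma> \<mu>w \<mu>v P W U \<longleftrightarrow>
     lmi_feasible A C D1 D2 Jl Ju lam a b \<gamma> \<mu>w \<mu>v P W U \<and>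
     (\<forall>a' b' \<gamma>' \<mu>w' \<mu>v' P' W' U'.
        lmi_feasible A C D1 D2 Jl Ju lam a' b' \<gamma>' \<mu>w' \<mu>v' P' W' U' \<longrightarrow>
        \<mu>w + \<mu>v \<le> \<mu>w' + \<mu>v')"

definition error_dynamics_hold ::
    "real^'nx^'nx \<Rightarrow> real^'nu^'nx \<Rightarrow> real^'nx^'ny \<Rightarrow> real^'nw^'nx \<Rightarrow> real^'nv^'ny \<Rightarrow>
     (real^'nx \<Rightarrow> real^'nx) \<Rightarrow> (real^'nx) set \<Rightarrow> real^'ny^'nx \<Rightarrow> bool" where
  "error_dynamics_hold A B C D1 D2 f X L \<longleftrightarrow>
     (\<forall>w v x xh. trajectory A B C D1 D2 f X L w v x xh \<longrightarrow>
       (\<forall>k. x (Suc k) - xh (Suc k) =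
          (A - L ** C) *v (x k - xh k) + (f (x k) - f (xh k)) + D1 *v w k - (L ** D2) *v v k))"

definition peak_to_peak_bound ::
    "real^'nx^'nx \<Rightarrow> real^'nu^'nx \<Rightarrow> real^'nx^'ny \<Rightarrow> real^'nw^'nx \<Rightarrow> real^'nv^'ny \<Rightarrow>
     (real^'nx \<Rightarrow> real^'nx) \<Rightarrow> (real^'nx) set \<Rightarrow>
     real^'nw \<Rightarrow> real^'nv \<Rightarrow> real^'nx \<Rightarrow> real^'nx \<Rightarrow> real \<Rightarrow>
     real \<Rightarrow> real \<Rightarrow> real^'nx^'nx \<Rightarrow> real^'ny^'nx \<Rightarrow> bool" where
  "peak_to_peak_bound A B C D1 D2 f X wbar vbar p0 x0bar lam \<mu>w \<mu>v P L \<longleftrightarrow>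
     (\<forall>w v x xh.
        trajectory A B C D1 D2 f X L w v x xh \<and>
        (\<forall>k. \<bar>w k\<bar> \<le> wbar \<and> \<bar>v k\<bar> \<le> vbar) \<and> \<bar>x 0 - p0\<bar> \<le> x0bar \<longrightarrow>
        (\<forall>k. norm (x k - xh k) \<le>
           sqrt ((\<mu>w + \<mu>v) *
             (lam * (1 - lam) ^ k * ((x 0 - xh 0) \<bullet> (P *v (x 0 - xh 0)))
              + \<mu>w * (wbar \<bullet> wbar) + \<mu>v * (vbar \<bullet> vbar)))))"

end

theory Submission
  imports Defs
begin

text \<open>The function \<open>V e = e \<bullet> (P *v e)\<close> is a Lyapunov function for the estimation error. The
  stability inequality is a negative quadratic form in six free vectors; it is tested on
  \<open>(e, d, w, v, e', J *v e)\<close>, where \<open>d\<close> is the increment of \<open>f\<close> and \<open>e'\<close> the next error. The fifth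
  block undoes a Schur complement, because \<open>2 e' \<bullet> (P e') - e' \<bullet> (P e')\<close> is the next value of \<open>V\<close>.
  In the sixth block the terms in \<open>U\<close> cancel and \<open>b (J e) \<bullet> (J e)\<close> remains. The two bounds on the
  increment, weighted with \<open>2 a\<close> and \<open>b\<close>, then have exactly the right sign to be discarded, which
  leaves the dissipation inequality (lemma \<open>stability_lmi_dissipation\<close>)
  \<open>V e' \<le> (1 - lam) V e + \<gamma> (w \<bullet> w + v \<bullet> v)\<close>. Its iteration is the geometric bound
  \<open>lam_le_geometric\<close>.

  The performance inequality is tested on \<open>(e, w, v, - e / \<mu>)\<close>, the minimiser over the last block,
  and bounds \<open>e \<bullet> e\<close> by \<open>\<mu> (lam V e + (\<mu>w - \<gamma>) w \<bullet> w + (\<mu>v - \<gamma>) v \<bullet> v)\<close>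
  (lemma \<open>performance_lmi_norm\<close>). At the amplitude bounds \<open>wbar\<close>, \<open>vbar\<close> the terms in \<open>\<gamma>\<close> cancel
  against the accumulated disturbance, which gives the peak-to-peak bound. At zero inputs it bounds
  the norm by the square root of \<open>\<mu> lam V e\<close>, and subadditivity of the square root separates initial
  error and inputs, which gives input-to-state stability.\<close>

section \<open>Quadratic forms of block matrices\<close>

definition vec_append :: "real^'m \<Rightarrow> real^'n \<Rightarrow> real^('m + 'n)" (infixr "\<frown>" 60) where
  "x \<frown> y = (\<chi> i. case i of Inl r \<Rightarrow> x $ r | Inr r \<Rightarrow> y $ r)"

lemma sum_UNIV_Plus:
  fixes g :: "'m::finite + 'n::finite \<Rightarrow> real"
  shows "(\<Sum>i\<in>UNIV. g i) = (\<Sum>i\<in>UNIV. g (Inl i)) + (\<Sum>i\<in>UNIV. g (Inr i))"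
  by (simp flip: UNIV_Plus_UNIV add: sum.Plus o_def)

lemma inner_vstack:
  "(y \<frown> z) \<bullet> ((M \<Zsemi> N) *v x) = y \<bullet> (M *v x) + z \<bullet> (N *v x)"
  by (simp add: inner_vec_def vstack_def vec_append_def matrix_vector_mult_def sum_UNIV_Plus)

lemma inner_sym_block:
  "(x \<frown> y) \<bullet> (sym_block M11 M21 M22 *v (x \<frown> y))
     = x \<bullet> (M11 *v x) + 2 * (y \<bullet> (M21 *v x)) + y \<bullet> (M22 *v y)"
proof -
  have "(\<Sum>i\<in>UNIV. x $ i * (\<Sum>j\<in>UNIV. M21 $ j $ i * y $ j)) = y \<bullet> (M21 *v x)"
    unfolding inner_vec_def matrix_vector_mult_def
    by (simp add: sum_distrib_left, subst sum.swap) (simp add: mult_ac)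
  then show ?thesis
    by (simp add: inner_vec_def sym_block_def vec_append_def matrix_vector_mult_def sum_UNIV_Plus
        distrib_left sum.distrib)
qed

lemma mat_vector_mult: "mat c *v x = c *\<^sub>R (x :: real^'n)"
  by (simp add: vec_eq_iff matrix_vector_mult_def mat_def if_distribR if_distrib[of "\<lambda>y. y * _"]
      cong: if_cong)

lemma minus_matrix_vector_mult: "(- M) *v x = - (M *v (x :: real^'n))"
  by (simp add: vec_eq_iff matrix_vector_mult_def sum_negf)

lemma inner_vector_matrix_mult_self: "x \<bullet> (x v* M) = x \<bullet> (M *v (x :: real^'n))"
  by (metis dot_lmul_matrix inner_commute)

lemma neg_def_le_0: "neg_def M \<Longrightarrow> z \<bullet> (M *v z) \<le> 0"
  by (cases "z = 0") (auto simp: neg_def_def intro: less_imp_le)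

lemma pos_def_ge_0: "pos_def M \<Longrightarrow> z \<bullet> (M *v z) \<ge> 0"
  by (cases "z = 0") (auto simp: pos_def_def intro: less_imp_le)

lemma pos_def_invertible: "pos_def P \<Longrightarrow> invertible P"
  unfolding invertible_left_inverse matrix_left_invertible_ker pos_def_def
  by (metis inner_zero_right less_irrefl)

section \<open>Consequences of the matrix inequalities\<close>

text \<open>The matrix inequality contains \<open>P\<close> times the observer gain, abbreviated \<open>W\<close>, and not the gain
  itself. Prescribing \<open>P *v e'\<close> rather than \<open>e'\<close> therefore avoids the inverse of \<open>P\<close> here.\<close>

lemma stability_lmi_dissipation:
  fixes P :: "real^'nx^'nx" and D1 :: "real^'nw^'nx" and D2 :: "real^'nv^'ny"
  assumes lmi: "neg_def (stability_lmi A C D1 D2 lam a b \<gamma> P W U J)"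
    and "a \<ge> 0" "b \<ge> 0"
    and mono: "d \<bullet> e \<le> e \<bullet> (J *v e)" and lip: "d \<bullet> d \<le> e \<bullet> ((transpose J ** J) *v e)"
    and step: "P *v e' = (P ** A - W ** C) *v e + P *v d + (P ** D1) *v w - (W ** D2) *v v"
  shows "e' \<bullet> (P *v e') \<le> (1 - lam) * (e \<bullet> (P *v e)) + \<gamma> * (w \<bullet> w + v \<bullet> v)"
proof -
  let ?s = "J *v e"
  let ?z = "e \<frown> d \<frown> w \<frown> v \<frown> e' \<frown> ?s"
  have "?z \<bullet> (stability_lmi A C D1 D2 lam a b \<gamma> P W U J *v ?z) \<le> 0"
    by (rule neg_def_le_0[OF lmi])
  then have form: "lam * (e \<bullet> (P *v e)) - e \<bullet> (P *v e) + 2 * a * (e \<bullet> (J *v e))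
      - 2 * a * (d \<bullet> e) - b * (d \<bullet> d) - \<gamma> * (w \<bullet> w) - \<gamma> * (v \<bullet> v)
      + 2 * (e' \<bullet> ((P ** A - W ** C) *v e) + e' \<bullet> (P *v d) + e' \<bullet> ((P ** D1) *v w)
             - e' \<bullet> ((W ** D2) *v v))
      - e' \<bullet> (P *v e') + b * (?s \<bullet> ?s) \<le> 0"
    by (simp add: stability_lmi_def inner_sym_block inner_vstack mat_vector_mult
        matrix_vector_mult_add_rdistrib matrix_vector_mult_diff_rdistrib
        scaleR_matrix_vector_assoc[symmetric] inner_vector_matrix_mult_self minus_matrix_vector_mult matrix_vector_mul_assoc[symmetric]
        inner_add_right inner_diff_right algebra_simps)
  have "e' \<bullet> ((P ** A - W ** C) *v e) + e' \<bullet> (P *v d) + e' \<bullet> ((P ** D1) *v w)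
      - e' \<bullet> ((W ** D2) *v v) = e' \<bullet> (P *v e')"
    by (simp add: step inner_add_right inner_diff_right)
  moreover have "e \<bullet> ((transpose J ** J) *v e) = ?s \<bullet> ?s"
    by (metis dot_lmul_matrix matrix_vector_mul_assoc vector_transpose_matrix transpose_transpose)
  then have "b * (d \<bullet> d) \<le> b * (?s \<bullet> ?s)"
    using lip \<open>b \<ge> 0\<close> by (simp add: mult_left_mono)
  moreover have "a * (d \<bullet> e) \<le> a * (e \<bullet> (J *v e))"
    using mono \<open>a \<ge> 0\<close> by (simp add: mult_left_mono)
  ultimately show ?thesis
    using form by (simp add: algebra_simps)
qed

text \<open>Here \<open>w\<close> and \<open>v\<close> are test vectors that need not be values of the disturbances: the
  amplitude bounds give the peak-to-peak bound, and zero gives input-to-state stability.\<close>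

lemma performance_lmi_norm:
  fixes P :: "real^'nx^'nx" and w :: "real^'nw" and v :: "real^'nv"
  assumes lmi: "pos_def (performance_lmi lam \<gamma> \<mu>w \<mu>v P
      :: real^('nx + 'nw + 'nv + 'nx)^('nx + 'nw + 'nv + 'nx))"
    and mu: "\<mu>w + \<mu>v > 0"
  shows "(norm e)\<^sup>2 \<le> (\<mu>w + \<mu>v)
      * (lam * (e \<bullet> (P *v e)) + (\<mu>w - \<gamma>) * (w \<bullet> w) + (\<mu>v - \<gamma>) * (v \<bullet> v))"
proof -
  let ?\<mu> = "\<mu>w + \<mu>v"
  let ?s = "(- (1 / ?\<mu>)) *\<^sub>R e"
  let ?z = "e \<frown> w \<frown> v \<frown> ?s"
  let ?Q = "lam * (e \<bullet> (P *v e)) + (\<mu>w - \<gamma>) * (w \<bullet> w) + (\<mu>v - \<gamma>) * (v \<bullet> v)"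
  have "0 \<le> ?z \<bullet> (performance_lmi lam \<gamma> \<mu>w \<mu>v P *v ?z)"
    by (rule pos_def_ge_0[OF lmi])
  also have "\<dots> = ?Q + 2 * (?s \<bullet> e) + ?\<mu> * (?s \<bullet> ?s)"
    unfolding performance_lmi_def inner_sym_block inner_vstack mat_vector_mult
    by (simp add: scaleR_matrix_vector_assoc[symmetric])
  also have "\<dots> = ?Q - (norm e)\<^sup>2 / ?\<mu>"
    using mu by (simp add: power2_norm_eq_inner divide_simps)
  finally show ?thesis
    using mu by (simp add: divide_simps mult.commute)
qed

text \<open>Multiplication by \<open>lam\<close> keeps the geometric series of the constant inputs out of the
  statement: its sum is at most \<open>c / lam\<close>.\<close>

lemma lam_le_geometric:
  fixes V :: "nat \<Rightarrow> real"
  assumes "\<And>i. i < k \<Longrightarrow> V (Suc i) \<le> (1 - lam) * V i + c"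
    and "0 < lam" "lam < 1" "0 \<le> c"
  shows "lam * V k \<le> lam * (1 - lam) ^ k * V 0 + c"
  using assms(1)
proof (induction k)
  case 0
  then show ?case using \<open>0 \<le> c\<close> by simp
next
  case (Suc k)
  then have "lam * V k \<le> lam * (1 - lam) ^ k * V 0 + c" by simp
  then have "(1 - lam) * (lam * V k) \<le> (1 - lam) * (lam * (1 - lam) ^ k * V 0 + c)"
    using \<open>lam < 1\<close> by (intro mult_left_mono) auto
  moreover have "lam * V (Suc k) \<le> lam * ((1 - lam) * V k + c)"
    using Suc.prems[of k] \<open>0 < lam\<close> by (intro mult_left_mono) auto
  ultimately show ?case by (simp add: algebra_simps)
qed

section \<open>Estimation error dynamics\<close>

lemma error_dynamics_hold: "error_dynamics_hold A B C D1 D2 f X L"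
  unfolding error_dynamics_hold_def
proof (intro allI impI)
  fix w v x xh k
  assume "trajectory A B C D1 D2 f X L w v x xh"
  then show "x (Suc k) - xh (Suc k) =
      (A - L ** C) *v (x k - xh k) + (f (x k) - f (xh k)) + D1 *v w k - (L ** D2) *v v k"
    unfolding trajectory_def plant_dynamics_def observer_dynamics_def
    by (auto simp: matrix_vector_mult_diff_rdistrib matrix_vector_mult_diff_distrib
        matrix_vector_mul_assoc[symmetric] matrix_vector_right_distrib algebra_simps)
qed

lemma trajectory_dissipation:
  fixes D1 :: "real^'nw^'nx" and D2 :: "real^'nv^'ny"
  assumes feas: "lmi_feasible A C D1 D2 Jl Ju lam a b \<gamma> \<mu>w \<mu>v P W U"
    and incr: "\<forall>p\<in>X. \<forall>q\<in>X. \<exists>J\<in>{Jl..Ju}.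
          (f p - f q) \<bullet> (p - q) \<le> (p - q) \<bullet> (J *v (p - q)) \<and>
          (f p - f q) \<bullet> (f p - f q) \<le> (p - q) \<bullet> ((transpose J ** J) *v (p - q))"
    and traj: "trajectory A B C D1 D2 f X (matrix_inv P ** W) w v x xh"
  defines "e \<equiv> \<lambda>k. x k - xh k"
  shows "e (Suc k) \<bullet> (P *v e (Suc k))
      \<le> (1 - lam) * (e k \<bullet> (P *v e k)) + \<gamma> * (w k \<bullet> w k + v k \<bullet> v k)"
proof -
  let ?L = "matrix_inv P ** W"
  let ?d = "f (x k) - f (xh k)"
  have "x k \<in> X" "xh k \<in> X" using traj by (auto simp: trajectory_def)
  then obtain J where J: "J \<in> {Jl..Ju}" "?d \<bullet> e k \<le> e k \<bullet> (J *v e k)"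
      "?d \<bullet> ?d \<le> e k \<bullet> ((transpose J ** J) *v e k)"
    using incr unfolding e_def by blast
  have "invertible P" using feas pos_def_invertible by (auto simp: lmi_feasible_def)
  then have "P ** matrix_inv P = mat 1"
    unfolding invertible_def matrix_inv_def by (rule someI2_ex) simp
  then have inv: "P *v (matrix_inv P *v z) = z" for z
    by (simp add: matrix_vector_mul_assoc)
  have "e (Suc k) = (A - ?L ** C) *v e k + ?d + D1 *v w k - (?L ** D2) *v v k"
    using error_dynamics_hold traj unfolding error_dynamics_hold_def e_def by blast
  then have "P *v e (Suc k)
      = (P ** A - W ** C) *v e k + P *v ?d + (P ** D1) *v w k - (W ** D2) *v v k"
    by (simp only: matrix_vector_mult_diff_rdistrib matrix_vector_mult_diff_distrib
        matrix_vector_right_distrib inv flip: matrix_vector_mul_assoc)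
  with J feas show ?thesis
    by (intro stability_lmi_dissipation[where a = a and b = b and J = J and d = ?d])
      (auto simp: lmi_feasible_def)
qed

section \<open>Input-to-state stability and the peak-to-peak bound\<close>

lemma inner_le_of_abs_le: "\<bar>x\<bar> \<le> y \<Longrightarrow> x \<bullet> x \<le> y \<bullet> (y :: real^'n)"
proof -
  assume "\<bar>x\<bar> \<le> y"
  then have "\<bar>x $ i\<bar> \<le> y $ i" for i by (simp add: less_eq_vec_def abs_vec_def)
  then have "x $ i * x $ i \<le> y $ i * y $ i" for i
    using abs_le_square_iff[of "x $ i" "y $ i"] abs_ge_self[of "y $ i"]
    unfolding power2_eq_square by (meson order_trans)
  then show ?thesis by (simp add: inner_vec_def sum_mono)
qed

lemma class_K_linear: "c > 0 \<Longrightarrow> class_K (\<lambda>r. c * r)"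
  unfolding class_K_def by (auto intro!: continuous_intros strict_mono_onI)

lemma class_KL_exponential:
  assumes "c > 0" "0 < q" "q < 1"
  shows "class_KL (\<lambda>r t. c * q powr t * r)"
proof -
  have "((\<lambda>t. c * q powr t * r) \<longlongrightarrow> 0) at_top" for r
  proof -
    have "((\<lambda>t. exp (t * ln q)) \<longlongrightarrow> 0) at_top"
      using assms filterlim_tendsto_neg_mult_at_bot[OF tendsto_const[of "ln q"] _ filterlim_ident]
      by (intro filterlim_compose[OF exp_at_bot]) (simp add: mult.commute)
    then have "((\<lambda>t. q powr t) \<longlongrightarrow> 0) at_top" using assms by (simp add: powr_def)
    then have "((\<lambda>t. c * q powr t * r) \<longlongrightarrow> c * 0 * r) at_top"
      by (intro tendsto_mult tendsto_const)
    then show ?thesis by simp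
  qed
  moreover have "antimono_on {0..} (\<lambda>t. c * q powr t * r)" if "r \<ge> 0" for r
    using assms that
    by (intro monotone_onI mult_right_mono mult_left_mono powr_mono') auto
  moreover have "continuous_on ({0..} \<times> {0..}) (\<lambda>(r, t). c * q powr t * r)"
    using assms by (auto simp: case_prod_beta intro!: continuous_intros)
  ultimately show ?thesis
    using assms by (auto simp: class_KL_def intro!: class_K_linear)
qed

text \<open>The decay rate of the norm is the square root of the rate \<open>1 - lam\<close> of the quadratic form. The
  gain of the initial error involves a bound on the operator norm of \<open>P\<close>; adding one to it makes it
  positive without a case distinction.\<close>

lemma feasible_imp_input_to_state_stable:
  fixes D1 :: "real^'nw^'nx" and D2 :: "real^'nv^'ny"
  assumes feas: "lmi_feasible A C D1 D2 Jl Ju lam a b \<gamma> \<mu>w \<mu>v P W U"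
    and "Jl \<le> Ju"
    and incr: "\<forall>p\<in>X. \<forall>q\<in>X. \<exists>J\<in>{Jl..Ju}.
          (f p - f q) \<bullet> (p - q) \<le> (p - q) \<bullet> (J *v (p - q)) \<and>
          (f p - f q) \<bullet> (f p - f q) \<le> (p - q) \<bullet> ((transpose J ** J) *v (p - q))"
    and lam: "0 < lam" "lam < 1"
  shows "input_to_state_stable (error_trajectory A B C D1 D2 f X (matrix_inv P ** W))"
proof -
  define \<mu> where "\<mu> = \<mu>w + \<mu>v"
  define K where "K = onorm ((*v) P) + 1"
  define q where "q = sqrt (1 - lam)"
  have pos: "\<gamma> > 0" "\<mu> > 0" using feas by (auto simp: lmi_feasible_def \<mu>_def)
  have perf: "pos_def (performance_lmi lam \<gamma> \<mu>w \<mu>v P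
      :: real^('nx + 'nw + 'nv + 'nx)^('nx + 'nw + 'nv + 'nx))"
    using feas \<open>Jl \<le> Ju\<close> by (auto simp: lmi_feasible_def)
  have blin: "bounded_linear ((*v) P)" by simp
  have K: "K > 0" using onorm_pos_le[OF blin] by (simp add: K_def)
  have PK: "z \<bullet> (P *v z) \<le> K * (norm z)\<^sup>2" for z
  proof -
    have "z \<bullet> (P *v z) \<le> norm z * norm (P *v z)" by (rule norm_cauchy_schwarz)
    also have "\<dots> \<le> norm z * (K * norm z)"
      using add_mono[OF onorm[OF blin, of z] norm_ge_zero[of z]] by (intro mult_left_mono) (auto simp: K_def algebra_simps)
    finally show ?thesis by (simp add: power2_eq_square algebra_simps)
  qed
  define \<beta> where "\<beta> = (\<lambda>r t. sqrt (\<mu> * lam * K) * q powr t * r)"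
  define \<sigma> where "\<sigma> = (\<lambda>r. sqrt (\<mu> * \<gamma>) * r)"
  have q: "0 < q" "q < 1" "q\<^sup>2 = 1 - lam" using lam by (auto simp: q_def)
  have bound: "norm (e k) \<le> \<beta> (norm (e 0)) (real k)
      + \<sigma> (Sup (insert 0 ((\<lambda>i. norm (w i, v i)) ` {..<k})))"
    if err: "error_trajectory A B C D1 D2 f X (matrix_inv P ** W) e w v" for e w v k
  proof -
    obtain x xh where traj: "trajectory A B C D1 D2 f X (matrix_inv P ** W) w v x xh"
      and e: "e = (\<lambda>k. x k - xh k)"
      using err by (auto simp: error_trajectory_def)
    define V where "V = (\<lambda>k. e k \<bullet> (P *v e k))"
    define M where "M = Sup (insert 0 ((\<lambda>i. norm (w i, v i)) ` {..<k}))"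
    have bdd: "bdd_above (insert 0 ((\<lambda>i. norm (w i, v i)) ` {..<k}))"
      by (intro bdd_above_finite) simp
    have "M \<ge> 0" unfolding M_def by (intro cSup_upper bdd) simp
    have "V (Suc i) \<le> (1 - lam) * V i + \<gamma> * M\<^sup>2" if "i < k" for i
    proof -
      have "norm (w i, v i) \<le> M" unfolding M_def using that by (intro cSup_upper bdd) simp
      then have "(norm (w i, v i))\<^sup>2 \<le> M\<^sup>2" by (intro power_mono) auto
      then have "w i \<bullet> w i + v i \<bullet> v i \<le> M\<^sup>2" by (simp add: power2_norm_eq_inner)
      then have "\<gamma> * (w i \<bullet> w i + v i \<bullet> v i) \<le> \<gamma> * M\<^sup>2"
        using pos by (intro mult_left_mono) auto
      with trajectory_dissipation[OF feas incr traj, of i] show ?thesis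
        by (simp add: V_def e)
    qed
    then have "lam * V k \<le> lam * (1 - lam) ^ k * V 0 + \<gamma> * M\<^sup>2"
      using lam pos by (intro lam_le_geometric) auto
    also have "\<dots> \<le> lam * (1 - lam) ^ k * (K * (norm (e 0))\<^sup>2) + \<gamma> * M\<^sup>2"
      using lam PK[of "e 0"] by (intro add_right_mono mult_left_mono) (auto simp: V_def)
    finally have lV: "\<mu> * (lam * V k)
        \<le> \<mu> * (lam * (1 - lam) ^ k * (K * (norm (e 0))\<^sup>2) + \<gamma> * M\<^sup>2)"
      using pos by (intro mult_left_mono) auto
    have "(norm (e k))\<^sup>2 \<le> \<mu> * (lam * V k)"
      using performance_lmi_norm[OF perf, of "e k" 0 0] pos by (simp add: V_def \<mu>_def)
    also note lV
    also have "\<mu> * (lam * (1 - lam) ^ k * (K * (norm (e 0))\<^sup>2) + \<gamma> * M\<^sup>2)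
        = (\<beta> (norm (e 0)) (real k))\<^sup>2 + (\<sigma> M)\<^sup>2"
    proof -
      have "(q powr real k)\<^sup>2 = (1 - lam) ^ k"
        by (metis q(1,3) powr_realpow power_mult mult.commute)
      then show ?thesis
        using lam pos K by (simp add: \<beta>_def \<sigma>_def power_mult_distrib algebra_simps)
    qed
    finally have "norm (e k) \<le> sqrt ((\<beta> (norm (e 0)) (real k))\<^sup>2 + (\<sigma> M)\<^sup>2)"
      by (rule real_le_rsqrt)
    also have "\<dots> \<le> \<beta> (norm (e 0)) (real k) + \<sigma> M"
      using lam pos K q \<open>M \<ge> 0\<close> by (intro sqrt_sum_squares_le_sum) (auto simp: \<beta>_def \<sigma>_def)
    finally show ?thesis by (simp add: M_def)
  qed
  have "class_KL \<beta>" unfolding \<beta>_def using lam pos K q by (intro class_KL_exponential) auto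
  moreover have "class_K \<sigma>" unfolding \<sigma>_def using pos by (intro class_K_linear) auto
  ultimately show ?thesis
    unfolding input_to_state_stable_def using bound by blast
qed

lemma feasible_imp_peak_to_peak_bound:
  fixes D1 :: "real^'nw^'nx" and D2 :: "real^'nv^'ny"
  assumes feas: "lmi_feasible A C D1 D2 Jl Ju lam a b \<gamma> \<mu>w \<mu>v P W U"
    and "Jl \<le> Ju"
    and incr: "\<forall>p\<in>X. \<forall>q\<in>X. \<exists>J\<in>{Jl..Ju}.
          (f p - f q) \<bullet> (p - q) \<le> (p - q) \<bullet> (J *v (p - q)) \<and>
          (f p - f q) \<bullet> (f p - f q) \<le> (p - q) \<bullet> ((transpose J ** J) *v (p - q))"
    and lam: "0 < lam" "lam < 1"
  shows "peak_to_peak_bound A B C D1 D2 f X wbar vbar p0 x0bar lam \<mu>w \<mu>v P (matrix_inv P ** W)"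
  unfolding peak_to_peak_bound_def
proof (intro allI impI, elim conjE)
  fix w v x xh k
  assume traj: "trajectory A B C D1 D2 f X (matrix_inv P ** W) w v x xh"
    and wv: "\<forall>k. \<bar>w k\<bar> \<le> wbar \<and> \<bar>v k\<bar> \<le> vbar"
  define V where "V = (\<lambda>k. (x k - xh k) \<bullet> (P *v (x k - xh k)))"
  have pos: "\<gamma> > 0" "\<mu>w + \<mu>v > 0" using feas by (auto simp: lmi_feasible_def)
  have perf: "pos_def (performance_lmi lam \<gamma> \<mu>w \<mu>v P
      :: real^('nx + 'nw + 'nv + 'nx)^('nx + 'nw + 'nv + 'nx))"
    using feas \<open>Jl \<le> Ju\<close> by (auto simp: lmi_feasible_def)
  have "V (Suc i) \<le> (1 - lam) * V i + \<gamma> * (wbar \<bullet> wbar + vbar \<bullet> vbar)" for i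
  proof -
    have "\<gamma> * (w i \<bullet> w i + v i \<bullet> v i) \<le> \<gamma> * (wbar \<bullet> wbar + vbar \<bullet> vbar)"
      using pos wv by (intro mult_left_mono add_mono inner_le_of_abs_le) auto
    with trajectory_dissipation[OF feas incr traj, of i] show ?thesis by (simp add: V_def)
  qed
  then have lV: "lam * V k
      \<le> lam * (1 - lam) ^ k * V 0 + \<gamma> * (wbar \<bullet> wbar + vbar \<bullet> vbar)"
    using lam pos by (intro lam_le_geometric) auto
  have "(norm (x k - xh k))\<^sup>2 \<le> (\<mu>w + \<mu>v)
      * (lam * V k + (\<mu>w - \<gamma>) * (wbar \<bullet> wbar) + (\<mu>v - \<gamma>) * (vbar \<bullet> vbar))"
    using performance_lmi_norm[OF perf pos(2)] by (simp add: V_def)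
  also have "\<dots> \<le> (\<mu>w + \<mu>v)
      * (lam * (1 - lam) ^ k * V 0 + \<mu>w * (wbar \<bullet> wbar) + \<mu>v * (vbar \<bullet> vbar))"
    using lV pos by (intro mult_left_mono) (auto simp: algebra_simps)
  finally show "norm (x k - xh k) \<le> sqrt ((\<mu>w + \<mu>v) *
      (lam * (1 - lam) ^ k * ((x 0 - xh 0) \<bullet> (P *v (x 0 - xh 0)))
        + \<mu>w * (wbar \<bullet> wbar) + \<mu>v * (vbar \<bullet> vbar)))"
    unfolding V_def by (rule real_le_rsqrt)
qed

theorem theorem1:
  fixes A :: "real^'nx^'nx" and B :: "real^'nu^'nx" and C :: "real^'nx^'ny"
    and D1 :: "real^'nw^'nx" and D2 :: "real^'nv^'ny"
    and f :: "real^'nx \<Rightarrow> real^'nx" and X :: "(real^'nx) set"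
    and Jl Ju :: "real^'nx^'nx"
    and wbar :: "real^'nw" and vbar :: "real^'nv" and p0 x0bar :: "real^'nx"
    and lam :: real
  assumes f_diff: "\<forall>x. f differentiable (at x)"
    and J_interval: "Jl \<le> Ju"
    and jacobian_bounds: "\<forall>x\<in>X. Jl \<le> jacobian f (at x) \<and> jacobian f (at x) \<le> Ju"
    and increment_bounds: "\<forall>p\<in>X. \<forall>q\<in>X. \<exists>J\<in>{Jl..Ju}.
          (f p - f q) \<bullet> (p - q) \<le> (p - q) \<bullet> (J *v (p - q)) \<and>
          (f p - f q) \<bullet> (f p - f q) \<le> (p - q) \<bullet> ((transpose J ** J) *v (p - q))"
    and lam: "0 < lam" "lam < 1"
  shows "(\<forall>a b \<gamma> \<mu>w \<mu>v P W U.
            lmi_feasible A C D1 D2 Jl Ju lam a b \<gamma> \<mu>w \<mu>v P W U \<longrightarrow>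
            (let L = matrix_inv P ** W in
              error_dynamics_hold A B C D1 D2 f X L \<and>
              input_to_state_stable (error_trajectory A B C D1 D2 f X L) \<and>
              peak_to_peak_bound A B C D1 D2 f X wbar vbar p0 x0bar lam \<mu>w \<mu>v P L)) \<and>
         (\<forall>a b \<gamma> \<mu>w \<mu>v P W U.
            lmi_optimal A C D1 D2 Jl Ju lam a b \<gamma> \<mu>w \<mu>v P W U \<longrightarrow>
            (let L = matrix_inv P ** W in
              error_dynamics_hold A B C D1 D2 f X L \<and>
              input_to_state_stable (error_trajectory A B C D1 D2 f X L) \<and>
              peak_to_peak_bound A B C D1 D2 f X wbar vbar p0 x0bar lam \<mu>w \<mu>v P L))"
  unfolding Let_def lmi_optimal_def
  by (blast intro: error_dynamics_hold
      feasible_imp_input_to_state_stable[OF _ J_interval increment_bounds lam]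
      feasible_imp_peak_to_peak_bound[OF _ J_interval increment_bounds lam])

end
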